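(* Let $1\le p<\infty$, and let $u:\mathbb{N}\to\mathbb{C}$ and $\phi:\mathbb{N}\to\mathbb{N}$ be such that $uC_\phi$ is a bounded linear operator on $\ell_p$. Then the quotient space $\ell_p/N(uC_\phi)$ is infinite dimensional if and only if $\phi(S(u))$ is an infinite set.
   Context: $\mathbb{N}$ is the set of positive integers; $\ell_p$ is the Banach space of $p$-summable complex sequences, viewed as functions on $\mathbb{N}$. The operator $uC_\phi$ is defined by $uC_\phi(f)=u\cdot(f\circ\phi)$, i.e. $(uC_\phi f)(m)=u(m)f(\phi(m))$. $N(T)$ is the null space of $T$; $S(u)=\{n\in\mathbb{N}: u(n)\ne 0\}$. *)

theory Defs
  imports "HOL-Analysis.Infinite_Sum" "HOL-Algebra.AbelCoset" "Jordan_Normal_Form.VS_Connect"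
begin

section \<open>Quotients of modules and vector spaces\<close>

text \<open>
  Addition is the addition of cosets from \<^theory>\<open>HOL-Algebra.AbelCoset\<close>. The scalar multiple of
  the coset \<open>N + x\<close> is \<open>N + c x\<close>; the summand \<open>N\<close> is needed because the elementwise multiple
  of a coset by \<open>c = 0\<close> is \<open>{0}\<close> and not \<open>N\<close>. The fields \<open>mult\<close> and \<open>one\<close>
  are inherited by the record type of modules and play no role.
\<close>

definition quotient_module :: "('a, 'v, 'm) module_scheme \<Rightarrow> 'v set \<Rightarrow> ('a, 'v set) module" where
  "quotient_module M N =
     \<lparr>carrier = a_rcosets\<^bsub>M\<^esub> N, mult = undefined, one = undefined,
      zero = N, add = set_add M,
      smult = (\<lambda>c X. N <+>\<^bsub>M\<^esub> ((\<lambda>x. c \<odot>\<^bsub>M\<^esub> x) ` X))\<rparr>"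

context
  fixes R (structure) and M (structure) and N
  assumes sub: "submodule R N M"
begin

interpretation M: module R M
  using sub by (simp add: submodule_def)

interpretation N: abelian_subgroup N M
proof (rule abelian_subgroupI3)
  have neg: "\<ominus>\<^bsub>M\<^esub> x \<in> N" if "x \<in> N" for x
  proof -
    have "x \<in> carrier M" using sub that by (auto simp: submodule_def)
    then have "\<ominus>\<^bsub>M\<^esub> x = (\<ominus>\<^bsub>R\<^esub> \<one>\<^bsub>R\<^esub>) \<odot>\<^bsub>M\<^esub> x"
      by (simp add: M.smult_l_minus)
    then show ?thesis using sub that by (simp add: submodule_def)
  qed
  show "additive_subgroup N M"
    by (rule additive_subgroupI, rule group.subgroupI[OF M.a_group])
      (use sub neg in \<open>auto simp: submodule_def a_inv_def\<close>)
qed (rule M.abelian_group_axioms)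

lemma quotient_module_smult:
  assumes "c \<in> carrier R" "x \<in> carrier M"
  shows "c \<odot>\<^bsub>quotient_module M N\<^esub> (N +>\<^bsub>M\<^esub> x) = N +>\<^bsub>M\<^esub> (c \<odot>\<^bsub>M\<^esub> x)"
proof -
  have NM: "n \<in> carrier M" if "n \<in> N" for n using N.a_subset that by auto
  have smN: "c \<odot>\<^bsub>M\<^esub> n \<in> N" if "n \<in> N" for n
    using sub that assms by (auto simp: submodule_def)
  have "n \<oplus>\<^bsub>M\<^esub> c \<odot>\<^bsub>M\<^esub> (n' \<oplus>\<^bsub>M\<^esub> x) \<in> N +>\<^bsub>M\<^esub> (c \<odot>\<^bsub>M\<^esub> x)" if "n \<in> N" "n' \<in> N" for n n'
  proof -
    have "n \<oplus>\<^bsub>M\<^esub> c \<odot>\<^bsub>M\<^esub> (n' \<oplus>\<^bsub>M\<^esub> x) = (n \<oplus>\<^bsub>M\<^esub> c \<odot>\<^bsub>M\<^esub> n') \<oplus>\<^bsub>M\<^esub> c \<odot>\<^bsub>M\<^esub> x"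
      using that assms NM by (simp add: M.smult_r_distr M.a_assoc)
    then show ?thesis using that smN by (auto simp: a_r_coset_def')
  qed
  moreover have "n \<oplus>\<^bsub>M\<^esub> c \<odot>\<^bsub>M\<^esub> x = n \<oplus>\<^bsub>M\<^esub> c \<odot>\<^bsub>M\<^esub> (\<zero>\<^bsub>M\<^esub> \<oplus>\<^bsub>M\<^esub> x)" if "n \<in> N" for n
    using assms by simp
  ultimately show ?thesis
    using N.zero_closed
    by (fastforce simp: quotient_module_def set_add_def' a_r_coset_def')
qed

lemma quotient_module_module: "module R (quotient_module M N)"
proof -
  let ?Q = "quotient_module M N"
  have add: "X \<oplus>\<^bsub>?Q\<^esub> Y = X <+>\<^bsub>M\<^esub> Y" for X Y by (simp add: quotient_module_def)
  have car: "carrier ?Q = (\<lambda>x. N +>\<^bsub>M\<^esub> x) ` carrier M"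
    by (auto simp: quotient_module_def A_RCOSETS_def')
  have plus: "(N +>\<^bsub>M\<^esub> x) \<oplus>\<^bsub>?Q\<^esub> (N +>\<^bsub>M\<^esub> y) = N +>\<^bsub>M\<^esub> (x \<oplus>\<^bsub>M\<^esub> y)"
    if "x \<in> carrier M" "y \<in> carrier M" for x y
    using that by (simp add: add N.a_rcos_sum)
  have zero: "\<zero>\<^bsub>?Q\<^esub> = N +>\<^bsub>M\<^esub> \<zero>\<^bsub>M\<^esub>"
    using N.a_subset by (simp add: quotient_module_def)
  have ab: "abelian_group ?Q"
  proof (rule abelian_groupI)
    fix X assume "X \<in> carrier ?Q"
    then obtain x where x: "x \<in> carrier M" "X = N +>\<^bsub>M\<^esub> x" by (auto simp: car)
    show "\<exists>Y\<in>carrier ?Q. Y \<oplus>\<^bsub>?Q\<^esub> X = \<zero>\<^bsub>?Q\<^esub>"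
      by (rule bexI[of _ "N +>\<^bsub>M\<^esub> (\<ominus>\<^bsub>M\<^esub> x)"])
        (use x in \<open>auto simp: plus zero M.l_neg car\<close>)
  qed (auto simp: car plus zero M.a_ac)
  show ?thesis
    by (rule moduleI[OF M.is_cring ab])
      (auto simp: car plus quotient_module_smult M.smult_l_distr M.smult_r_distr M.smult_assoc1)
qed

end

lemma quotient_module_vectorspace:
  assumes "subspace K W V"
  shows "vectorspace K (quotient_module V W)"
  using assms quotient_module_module unfolding subspace_def vectorspace_def by blast


section \<open>The sequence spaces \<open>\<ell>\<^sub>p\<close>\<close>

typedef pnat = "{n::nat. n \<ge> 1}"
  by auto

definition lp_norm :: "real \<Rightarrow> (pnat \<Rightarrow> complex) \<Rightarrow> real" where
  "lp_norm p f = (\<Sum>\<^sub>\<infinity>n. norm (f n) powr p) powr (1 / p)"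

definition lp_space :: "real \<Rightarrow> (complex, pnat \<Rightarrow> complex) module" where
  "lp_space p =
     \<lparr>carrier = {f. (\<lambda>n. norm (f n) powr p) summable_on UNIV},
      mult = undefined, one = undefined,
      zero = (\<lambda>n. 0), add = (\<lambda>f g n. f n + g n), smult = (\<lambda>c f n. c * f n)\<rparr>"

lemma lp_space_vectorspace:
  assumes "p \<ge> 1"
  shows "vectorspace class_ring (lp_space p)"
proof -
  have add: "(\<lambda>n. norm (f n + g n) powr p) summable_on UNIV"
    if "(\<lambda>n. norm (f n) powr p) summable_on UNIV" "(\<lambda>n. norm (g n) powr p) summable_on UNIV"
    for f g :: "pnat \<Rightarrow> complex"
  proof (rule summable_on_comparison_test)
    show "(\<lambda>n. 2 powr p * (norm (f n) powr p + norm (g n) powr p)) summable_on UNIV"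
      by (intro summable_on_cmult_right summable_on_add that)
    fix n
    have "norm (f n + g n) \<le> 2 * max (norm (f n)) (norm (g n))"
      using norm_triangle_ineq[of "f n" "g n"] by linarith
    then have "norm (f n + g n) powr p \<le> (2 * max (norm (f n)) (norm (g n))) powr p"
      using assms by (intro powr_mono2) auto
    also have "\<dots> = 2 powr p * max (norm (f n)) (norm (g n)) powr p"
      by (simp add: powr_mult)
    also have "\<dots> \<le> 2 powr p * (norm (f n) powr p + norm (g n) powr p)"
      by (intro mult_left_mono) (auto simp: max_def)
    finally show "norm (f n + g n) powr p \<le> 2 powr p * (norm (f n) powr p + norm (g n) powr p)" .
  qed auto
  have smult: "(\<lambda>n. norm (c * f n) powr p) summable_on UNIV"
    if "(\<lambda>n. norm (f n) powr p) summable_on UNIV" for c and f :: "pnat \<Rightarrow> complex"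
    using summable_on_cmult_right[OF that, of "norm c powr p"] by (simp add: norm_mult powr_mult)
  have ab: "abelian_group (lp_space p)"
  proof (rule abelian_groupI)
    fix f assume f: "f \<in> carrier (lp_space p)"
    show "\<exists>g\<in>carrier (lp_space p). g \<oplus>\<^bsub>lp_space p\<^esub> f = \<zero>\<^bsub>lp_space p\<^esub>"
      by (rule bexI[of _ "\<lambda>n. - f n"]) (use f in \<open>auto simp: lp_space_def\<close>)
  qed (auto simp: lp_space_def add add_ac)
  have "cring (class_ring :: complex ring)"
    using class_field[where 'a = complex] by (simp add: field_def domain_def)
  then have "module class_ring (lp_space p)"
    by (rule moduleI[OF _ ab])
      (auto simp: lp_space_def smult algebra_simps)
  then show ?thesis
    by (simp add: vectorspace_def class_field)
qed


section \<open>Weighted composition operators\<close>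

definition lp_bounded_linear :: "real \<Rightarrow> ((pnat \<Rightarrow> complex) \<Rightarrow> (pnat \<Rightarrow> complex)) \<Rightarrow> bool" where
  "lp_bounded_linear p T \<longleftrightarrow>
     linear_map class_ring (lp_space p) (lp_space p) T \<and>
     (\<exists>C. \<forall>f \<in> carrier (lp_space p). lp_norm p (T f) \<le> C * lp_norm p f)"

definition weighted_comp ::
    "(pnat \<Rightarrow> complex) \<Rightarrow> (pnat \<Rightarrow> pnat) \<Rightarrow> (pnat \<Rightarrow> complex) \<Rightarrow> (pnat \<Rightarrow> complex)" where
  "weighted_comp u \<phi> f = (\<lambda>m. u m * f (\<phi> m))"

definition null_space :: "real \<Rightarrow> ((pnat \<Rightarrow> complex) \<Rightarrow> (pnat \<Rightarrow> complex)) \<Rightarrow> (pnat \<Rightarrow> complex) set" where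
  "null_space p T = {f \<in> carrier (lp_space p). T f = \<zero>\<^bsub>lp_space p\<^esub>}"

lemma null_space_subspace:
  assumes "lp_bounded_linear p T"
  shows "subspace class_ring (null_space p T) (lp_space p)"
proof -
  interpret linear_map class_ring "lp_space p" "lp_space p" T
    using assms by (simp add: lp_bounded_linear_def)
  show ?thesis
    using kerT_is_subspace by (simp add: null_space_def ker_def)
qed

end

theory Submission
  imports Defs
begin

text \<open>
  Put \<open>A = \<phi>(S(u))\<close>. A sequence lies in the null space exactly when it vanishes on \<open>A\<close>, so the
  coset of \<open>f\<close> is determined by the restriction of \<open>f\<close> to \<open>A\<close>. If \<open>A\<close> is finite, the cosets of the
  unit vectors \<open>e\<^sub>a\<close> with \<open>a \<in> A\<close> span the quotient. For every \<open>a \<in> A\<close> the evaluation at \<open>a\<close> is well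
  defined on the quotient and vanishes on the cosets of all \<open>e\<^sub>b\<close> with \<open>b \<noteq> a\<close>, but not on that of
  \<open>e\<^sub>a\<close>; hence these cosets are linearly independent, and infinitely many of them exclude finite
  dimension.
\<close>

text \<open>A vanishing combination with a nonzero coefficient can be solved for the corresponding
  vector, which places it in the span of the others.\<close>

lemma (in vectorspace) lin_indpt_if_not_in_span:
  assumes "S \<subseteq> carrier V" "\<And>v. v \<in> S \<Longrightarrow> v \<notin> span (S - {v})"
  shows "lin_indpt S"
proof
  assume "lin_dep S"
  then obtain F a v where F: "finite F" "F \<subseteq> S" "a \<in> F \<rightarrow> carrier K" "lincomb a F = \<zero>\<^bsub>V\<^esub>"
      "v \<in> F" "a v \<noteq> \<zero>\<^bsub>K\<^esub>"
    by (auto simp: lin_dep_def)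
  then have "v \<in> span (F - {v})"
    using assms(1) by (intro lincomb_isolate(2)[where a = a]) auto
  also have "span (F - {v}) \<subseteq> span (S - {v})"
    using F(2) by (intro span_is_monotone) auto
  finally show False
    using assms(2) F(2,5) by blast
qed

definition unit_seq :: "pnat \<Rightarrow> pnat \<Rightarrow> complex" where
  "unit_seq a = (\<lambda>n. if n = a then 1 else 0)"

locale weighted_comp_operator =
  fixes p :: real and u :: "pnat \<Rightarrow> complex" and \<phi> :: "pnat \<Rightarrow> pnat"
  assumes p: "1 \<le> p"
    and bounded: "lp_bounded_linear p (weighted_comp u \<phi>)"
begin

abbreviation "L \<equiv> lp_space p"
abbreviation "N \<equiv> null_space p (weighted_comp u \<phi>)"
abbreviation "Q \<equiv> quotient_module L N"
abbreviation "A \<equiv> \<phi> ` {n. u n \<noteq> 0}"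
abbreviation "coset f \<equiv> N +>\<^bsub>L\<^esub> f"

sublocale L: vectorspace class_ring L
  by (rule lp_space_vectorspace[OF p])

sublocale Q: vectorspace class_ring Q
  by (rule quotient_module_vectorspace[OF null_space_subspace[OF bounded]])

lemma L_simps [simp]:
  "\<zero>\<^bsub>L\<^esub> = (\<lambda>n. 0)" "f \<oplus>\<^bsub>L\<^esub> g = (\<lambda>n. f n + g n)" "c \<odot>\<^bsub>L\<^esub> f = (\<lambda>n. c * f n)"
  by (simp_all add: lp_space_def)

lemma L_add: "f \<in> carrier L \<Longrightarrow> g \<in> carrier L \<Longrightarrow> (\<lambda>n. f n + g n) \<in> carrier L"
  using L.M.a_closed[of f g] by simp

lemma L_smult: "f \<in> carrier L \<Longrightarrow> (\<lambda>n. c * f n) \<in> carrier L"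
  using L.smult_closed[of c f] by simp

lemma L_diff:
  assumes "f \<in> carrier L" "g \<in> carrier L"
  shows "(\<lambda>n. f n - g n) \<in> carrier L"
  using L_add[OF assms(1) L_smult[OF assms(2), of "- 1"]] by simp

lemma unit_seq_carrier: "unit_seq a \<in> carrier L"
proof -
  have "(\<lambda>n. norm (unit_seq a n) powr p) summable_on {a}"
    by simp
  then have "(\<lambda>n. norm (unit_seq a n) powr p) summable_on UNIV"
    by (subst summable_on_cong_neutral[where T = "{a}" and g = "\<lambda>n. norm (unit_seq a n) powr p"])
      (auto simp: unit_seq_def)
  then show ?thesis
    by (simp add: lp_space_def)
qed

text \<open>The equation \<open>u m * f (\<phi> m) = 0\<close> constrains \<open>f\<close> only
  where \<open>u m\<close> is nonzero, that is, at the points of \<open>A\<close>.\<close>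

lemma mem_null_space: "f \<in> N \<longleftrightarrow> f \<in> carrier L \<and> (\<forall>a\<in>A. f a = 0)"
  by (auto simp: null_space_def weighted_comp_def fun_eq_iff)

text \<open>Members of a coset differ by elements of \<open>N\<close>, which vanish on
  \<open>A\<close>. This turns questions about cosets into comparisons of values on
  \<open>A\<close>.\<close>

lemma coset_eq:
  assumes "f \<in> carrier L"
  shows "coset f = {h \<in> carrier L. \<forall>a\<in>A. h a = f a}"
proof (intro equalityI subsetI)
  fix h assume "h \<in> coset f"
  then show "h \<in> {h \<in> carrier L. \<forall>a\<in>A. h a = f a}"
    using assms by (auto simp: a_r_coset_def' mem_null_space intro: L_add)
next
  fix h assume h: "h \<in> {h \<in> carrier L. \<forall>a\<in>A. h a = f a}"
  then have "(\<lambda>n. h n - f n) \<in> N"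
    using assms by (auto simp: mem_null_space intro: L_diff)
  then show "h \<in> coset f"
    by (auto simp: a_r_coset_def' intro!: bexI[of _ "\<lambda>n. h n - f n"])
qed

lemma carrier_Q: "carrier Q = coset ` carrier L"
  by (auto simp: quotient_module_def A_RCOSETS_def')

lemma coset_add:
  assumes "f \<in> carrier L" "g \<in> carrier L"
  shows "coset f \<oplus>\<^bsub>Q\<^esub> coset g = coset (\<lambda>n. f n + g n)"
proof (intro equalityI subsetI)
  fix h assume "h \<in> coset f \<oplus>\<^bsub>Q\<^esub> coset g"
  then show "h \<in> coset (\<lambda>n. f n + g n)"
    using assms by (auto simp: quotient_module_def set_add_def' coset_eq L_add)
next
  fix h assume h: "h \<in> coset (\<lambda>n. f n + g n)"
  \<comment> \<open>Split \<open>h\<close> as \<open>(h - g) + g\<close>, with \<open>g\<close>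
    representing its own coset.\<close>
  then have "(\<lambda>n. h n - g n) \<in> coset f"
    using assms by (auto simp: coset_eq L_add L_diff)
  moreover have "g \<in> coset g"
    using assms by (simp add: coset_eq)
  ultimately show "h \<in> coset f \<oplus>\<^bsub>Q\<^esub> coset g"
    by (force simp: quotient_module_def set_add_def')
qed

lemma coset_smult:
  assumes "f \<in> carrier L"
  shows "c \<odot>\<^bsub>Q\<^esub> coset f = coset (\<lambda>n. c * f n)"
  using quotient_module_smult[of class_ring N L c f] null_space_subspace[OF bounded] assms
  by (simp add: subspace_def)

lemma unit_cosets_carrier: "(\<lambda>a. coset (unit_seq a)) ` B \<subseteq> carrier Q"
  by (auto simp: carrier_Q unit_seq_carrier)

text \<open>Induction over \<open>F\<close>. Membership in the carrier is carried along because
  \<open>coset_add\<close> requires it of the partial sum.\<close>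

lemma coset_sum_in_span:
  assumes "finite F" "F \<subseteq> B"
  shows "(\<lambda>n. \<Sum>a\<in>F. c a * unit_seq a n) \<in> carrier L \<and>
         coset (\<lambda>n. \<Sum>a\<in>F. c a * unit_seq a n) \<in> Q.span ((\<lambda>a. coset (unit_seq a)) ` B)"
proof -
  let ?E = "(\<lambda>a. coset (unit_seq a)) ` B"
  interpret span: submodule class_ring "Q.span ?E" Q
    by (rule Q.span_is_submodule[OF unit_cosets_carrier])
  show ?thesis
    using assms
  proof (induction F rule: finite_induct)
    case empty
    have "\<zero>\<^bsub>Q\<^esub> = coset (\<lambda>n. 0)"
      using L.M.zero_closed by (auto simp: quotient_module_def coset_eq mem_null_space)
    then show ?case
      using span.zero_closed L.M.zero_closed by simp
  next
    case (insert x F)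
    let ?s = "\<lambda>n. \<Sum>a\<in>F. c a * unit_seq a n"
    have s: "?s \<in> carrier L" "coset ?s \<in> Q.span ?E"
      using insert by auto
    have x: "(\<lambda>n. c x * unit_seq x n) \<in> carrier L"
      by (intro L_smult unit_seq_carrier)
    have "coset (unit_seq x) \<in> Q.span ?E"
      using Q.in_own_span[OF unit_cosets_carrier] insert.prems by auto
    then have "c x \<odot>\<^bsub>Q\<^esub> coset (unit_seq x) \<oplus>\<^bsub>Q\<^esub> coset ?s \<in> Q.span ?E"
      using s(2) by (intro span.m_closed span.smult_closed) auto
    then have "coset (\<lambda>n. c x * unit_seq x n + ?s n) \<in> Q.span ?E"
      by (simp only: coset_smult unit_seq_carrier coset_add x s(1))
    then show ?case
      using L_add[OF x s(1)] insert.hyps by simp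
  qed
qed

lemma fin_dim_if_finite:
  assumes "finite A"
  shows "Q.fin_dim"
proof -
  let ?E = "(\<lambda>a. coset (unit_seq a)) ` A"
  note E = unit_cosets_carrier[of A]
  have "carrier Q \<subseteq> Q.span ?E"
  proof
    fix X assume "X \<in> carrier Q"
    then obtain f where f: "f \<in> carrier L" "X = coset f"
      by (auto simp: carrier_Q)
    \<comment> \<open>This finite combination agrees with \<open>f\<close> on \<open>A\<close>; the
      two may differ elsewhere, but only by an element of \<open>N\<close>.\<close>
    let ?s = "\<lambda>n. \<Sum>a\<in>A. f a * unit_seq a n"
    have s: "?s \<in> carrier L" "coset ?s \<in> Q.span ?E"
      using coset_sum_in_span[OF assms order.refl, of f] by auto
    have "?s a = f a" if "a \<in> A" for a
      using that assms by (simp add: unit_seq_def if_distrib cong: if_cong)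
    then have "coset ?s = X"
      unfolding f(2) coset_eq[OF f(1)] coset_eq[OF s(1)] by simp
    then show "X \<in> Q.span ?E"
      using s(2) by simp
  qed
  then have "Q.gen_set ?E"
    using Q.span_is_subset2[OF E] by blast
  then show ?thesis
    using E assms unfolding Q.fin_dim_def by blast
qed

text \<open>This is the kernel of evaluation at \<open>a\<close> on the quotient. Since
  \<open>a \<in> A\<close>, all representatives of a coset take the same value at \<open>a\<close>,
  so quantifying over them replaces a choice of representative.\<close>

lemma eval_kernel_submodule:
  assumes "a \<in> A"
  shows "submodule class_ring {X \<in> carrier Q. \<forall>f\<in>X. f a = 0} Q"
proof -
  have N: "f a = 0" if "f \<in> N" for f
    using that assms by (auto simp: mem_null_space)
  show ?thesis
  proof (rule submodule.intro)
    show "\<zero>\<^bsub>Q\<^esub> \<in> {X \<in> carrier Q. \<forall>f\<in>X. f a = 0}"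
      using Q.M.zero_closed N by (auto simp: quotient_module_def)
    fix X Y assume "X \<in> {X \<in> carrier Q. \<forall>f\<in>X. f a = 0}" "Y \<in> {X \<in> carrier Q. \<forall>f\<in>X. f a = 0}"
    then show "X \<oplus>\<^bsub>Q\<^esub> Y \<in> {X \<in> carrier Q. \<forall>f\<in>X. f a = 0}"
      using Q.M.a_closed[of X Y] by (auto simp: quotient_module_def set_add_def')
  next
    fix c :: complex and X assume "X \<in> {X \<in> carrier Q. \<forall>f\<in>X. f a = 0}"
    \<comment> \<open>A scalar multiple in \<open>Q\<close> is the elementwise multiple plus
      \<open>N\<close>, so the vanishing of \<open>N\<close> at \<open>a\<close> enters as
      well.\<close>
    then show "c \<odot>\<^bsub>Q\<^esub> X \<in> {X \<in> carrier Q. \<forall>f\<in>X. f a = 0}"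
      using Q.smult_closed[of c X] N by (auto simp: quotient_module_def set_add_def')
  qed (auto intro: Q.module_axioms)
qed

lemma not_fin_dim_if_infinite:
  assumes "infinite A"
  shows "\<not> Q.fin_dim"
proof
  assume fd: "Q.fin_dim"
  let ?e = "\<lambda>a. coset (unit_seq a)"
  note e = unit_cosets_carrier[of A]
  \<comment> \<open>Injectivity ensures that infinitely many indices give infinitely many
    cosets.\<close>
  have inj: "inj_on ?e A"
  proof (rule inj_onI)
    fix a b assume "a \<in> A" "?e a = ?e b"
    moreover have "unit_seq a \<in> ?e a"
      by (simp add: coset_eq unit_seq_carrier)
    ultimately have "unit_seq a a = unit_seq b a"
      unfolding coset_eq[OF unit_seq_carrier] by blast
    then show "a = b"
      by (simp add: unit_seq_def split: if_splits)
  qed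
  have "Q.lin_indpt (?e ` A)"
  proof (rule Q.lin_indpt_if_not_in_span[OF e])
    fix X assume "X \<in> ?e ` A"
    then obtain a where a: "a \<in> A" "X = ?e a"
      by blast
    \<comment> \<open>The submodule \<open>?K\<close> separates \<open>X\<close> from the span of
      the other cosets: it contains all of them, while \<open>unit_seq a\<close> takes the value 1
      at \<open>a\<close>.\<close>
    let ?K = "{X \<in> carrier Q. \<forall>f\<in>X. f a = 0}"
    have "?e ` A - {X} \<subseteq> ?K"
    proof
      fix Y assume Y: "Y \<in> ?e ` A - {X}"
      then obtain b where b: "Y = ?e b" "b \<noteq> a"
        using a(2) by auto
      have "f a = 0" if "f \<in> Y" for f
      proof -
        have "f a = unit_seq b a"
          using that a(1) unfolding b(1) coset_eq[OF unit_seq_carrier] by blast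
        then show ?thesis
          using b(2) by (simp add: unit_seq_def)
      qed
      moreover have "Y \<in> carrier Q"
        using Y e by blast
      ultimately show "Y \<in> ?K"
        by blast
    qed
    then have "Q.span (?e ` A - {X}) \<subseteq> ?K"
      by (rule Q.span_is_subset[OF _ eval_kernel_submodule[OF a(1)]])
    moreover have "unit_seq a \<in> X"
      by (simp add: a(2) coset_eq unit_seq_carrier)
    then have "X \<notin> ?K"
      by (force simp: unit_seq_def)
    ultimately show "X \<notin> Q.span (?e ` A - {X})"
      by blast
  qed
  \<comment> \<open>A linearly independent set in a finite-dimensional space is finite.\<close>
  then have "finite (?e ` A)"
    by (rule Q.fin_dim_li_fin[OF fd _ e])
  then show False
    using assms inj by (simp add: finite_image_iff)
qed

end

theorem lemma2p12:
  fixes p :: real and u :: "pnat \<Rightarrow> complex" and \<phi> :: "pnat \<Rightarrow> pnat"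
  assumes "1 \<le> p"
    and "lp_bounded_linear p (weighted_comp u \<phi>)"
  shows "\<not> vectorspace.fin_dim class_ring
              (quotient_module (lp_space p) (null_space p (weighted_comp u \<phi>)))
         \<longleftrightarrow> infinite (\<phi> ` {n. u n \<noteq> 0})"
proof -
  interpret weighted_comp_operator p u \<phi>
    using assms by unfold_locales
  show ?thesis
    using fin_dim_if_finite not_fin_dim_if_infinite by blast
qed

end
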